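(* Let $J$ be a finite set and let $\{T_j\}_{j\in J}$ be a finite family of $\alpha$-averaged operators on a real Hilbert space $H$ with $\bigcap_{j\in J}\operatorname{Fix}T_j\neq\emptyset$ and $\alpha\in(0,1)$. For each $t\in\mathbb{N}$, let $w_{j,t}\in\mathbb{R}$, $j\in J$, be such that $w_{j,t}\ge 0$ and $\sum_{j\in J}w_{j,t}=1$. Let $x^0\in H$ and let $(x^t)_{t\in\mathbb{N}}$ be generated by $$x^{t+1}=\sum_{j\in J}w_{j,t}T_j(x^t)\qquad\forall t\in\mathbb{N}.$$ Suppose that: (a) for each $j\in J$, the operator $T_j$ is bounded Hölder regular; (b) the collection $\{\operatorname{Fix}T_j\}_{j\in J}$ has a bounded Hölder regular intersection; (c) $\sigma:=\inf_{t\in\mathbb{N}}\inf_{j\in J_+(t)}w_{j,t}>0$, where $J_+(t):=\{j\in J: w_{j,t}>0\}$, and there exists $s\in\mathbb{N}$ such that $J_+(t)\cup J_+(t+1)\cup\dots\cup J_+(t+s-1)=J$ for all $t\in\mathbb{N}$. Then $x^t$ converges in norm to some $\bar x\in\bigcap_{j\in J}\operatorname{Fix}T_j$ at least with a sublinear rate $O(t^{-\rho})$ for some $\rho>0$; that is, there exist $\rho>0$ and $M\ge0$ with $\|x^t-\bar x\|\le M t^{-\rho}$ for all $t\ge1$. In particular, suppose that (c) holds and that (a) and (b) are replaced by (a$'$) for each $j\in J$, the operator $T_j$ is bounded Hölder regular with uniform exponent $\gamma_{1,j}\in(0,1]$; (b$'$) the collection $\{\operatorname{Fix}T_j\}_{j\in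 J}$ has a bounded Hölder regular intersection with uniform exponent $\gamma_2\in(0,1]$. Then there exist constants $M_1,M_2\ge0$ and $r\in[0,1)$ such that, for all $t\ge1$, $$\|x^t-\bar x\|\le\begin{cases}M_1\,t^{-\frac{\gamma}{2(1-\gamma)}},&\gamma\in(0,1),\\ M_2\,r^t,&\gamma=1,\end{cases}$$ where $\gamma:=\gamma_1\gamma_2$ and $\gamma_1:=\min\{\gamma_{1,j}: j\in J\}$.
   Context: $\mathbb{N}=\{0,1,2,\dots\}$; $\operatorname{Fix}T=\{x\in H: T(x)=x\}$; $d(x,A)=\inf_{a\in A}\|x-a\|$. An operator $T:H\to H$ is $\alpha$-averaged, $\alpha\in(0,1)$, if $T=(1-\alpha)I+\alpha R$ for some nonexpansive $R:H\to H$ (i.e. $\|R(x)-R(y)\|\le\|x-y\|$ for all $x,y$). An operator $T:H\to H$ is bounded Hölder regular if for each bounded set $K\subseteq H$ there exist $\gamma\in(0,1]$ and $\mu>0$ such that $d(x,\operatorname{Fix}T)\le\mu\|x-T(x)\|^\gamma$ for all $x\in K$. If the exponent $\gamma$ can be chosen independently of $K$, $T$ is bounded Hölder regular with uniform exponent $\gamma$. A collection $\{C_j\}_{j\in J}$ of closed convex subsets of $H$ with non-empty intersection has a bounded Hölder regular intersection if for each bounded set $K\subseteq H$ there exist $\gamma\in(0,1]$ and $\beta>0$ such that $d(x,\bigcap_{j\in J}C_j)\le\beta\left(\max_{j\in J}d(x,C_j)\right)^\gamma$ for all $x\in K$. If $\gamma$ can be chosen independently of $K$, this holds with uniform exponent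 $\gamma$. *)

theory Defs
  imports "HOL-Analysis.Analysis"
begin

definition Fix :: "('a \<Rightarrow> 'a) \<Rightarrow> 'a set"
  where "Fix T = {x. T x = x}"

definition nonexpansive :: "('a::real_normed_vector \<Rightarrow> 'a) \<Rightarrow> bool"
  where "nonexpansive R \<longleftrightarrow> (\<forall>x y. norm (R x - R y) \<le> norm (x - y))"

definition averaged :: "real \<Rightarrow> ('a::real_normed_vector \<Rightarrow> 'a) \<Rightarrow> bool"
  where "averaged \<alpha> T \<longleftrightarrow>
    0 < \<alpha> \<and> \<alpha> < 1 \<and>
    (\<exists>R. nonexpansive R \<and> T = (\<lambda>x. (1 - \<alpha>) *\<^sub>R x + \<alpha> *\<^sub>R R x))"

text \<open>
  The distance \<open>d(x, A)\<close> is \<^const>\<open>infdist\<close>.  The library sets \<open>infdist x {} = 0\<close>, so the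
  notions below have their intended meaning only for operators that have a fixed point and
  for families of sets with non-empty intersection.
\<close>

definition bounded_hoelder_regular :: "('a::real_normed_vector \<Rightarrow> 'a) \<Rightarrow> bool"
  where "bounded_hoelder_regular T \<longleftrightarrow>
    (\<forall>K. bounded K \<longrightarrow>
      (\<exists>\<gamma> \<mu>. 0 < \<gamma> \<and> \<gamma> \<le> 1 \<and> 0 < \<mu> \<and>
        (\<forall>x\<in>K. infdist x (Fix T) \<le> \<mu> * norm (x - T x) powr \<gamma>)))"

definition bounded_hoelder_regular_uniform :: "real \<Rightarrow> ('a::real_normed_vector \<Rightarrow> 'a) \<Rightarrow> bool"
  where "bounded_hoelder_regular_uniform \<gamma> T \<longleftrightarrow>
    0 < \<gamma> \<and> \<gamma> \<le> 1 \<and>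
    (\<forall>K. bounded K \<longrightarrow>
      (\<exists>\<mu>>0. \<forall>x\<in>K. infdist x (Fix T) \<le> \<mu> * norm (x - T x) powr \<gamma>))"

text \<open>
  The next two notions are meant for a finite non-empty index set \<open>J\<close> and closed convex sets
  \<open>C j\<close> with a common point.  These conditions are not part of the definitions; fixed point
  sets of averaged operators are closed and convex in any case.
\<close>

definition bounded_hoelder_regular_intersection ::
    "'j set \<Rightarrow> ('j \<Rightarrow> 'a::real_normed_vector set) \<Rightarrow> bool"
  where "bounded_hoelder_regular_intersection J C \<longleftrightarrow>
    (\<forall>K. bounded K \<longrightarrow>
      (\<exists>\<gamma> \<beta>. 0 < \<gamma> \<and> \<gamma> \<le> 1 \<and> 0 < \<beta> \<and>
        (\<forall>x\<in>K. infdist x (\<Inter>j\<in>J. C j) \<le> \<beta> * (MAX j\<in>J. infdist x (C j)) powr \<gamma>)))"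

definition bounded_hoelder_regular_intersection_uniform ::
    "real \<Rightarrow> 'j set \<Rightarrow> ('j \<Rightarrow> 'a::real_normed_vector set) \<Rightarrow> bool"
  where "bounded_hoelder_regular_intersection_uniform \<gamma> J C \<longleftrightarrow>
    0 < \<gamma> \<and> \<gamma> \<le> 1 \<and>
    (\<forall>K. bounded K \<longrightarrow>
      (\<exists>\<beta>>0. \<forall>x\<in>K. infdist x (\<Inter>j\<in>J. C j) \<le> \<beta> * (MAX j\<in>J. infdist x (C j)) powr \<gamma>))"

text \<open>The index set \<open>J\<^sub>+(t)\<close>.\<close>

definition active :: "'j set \<Rightarrow> ('j \<Rightarrow> nat \<Rightarrow> real) \<Rightarrow> nat \<Rightarrow> 'j set"
  where "active J w t = {j \<in> J. w j t > 0}"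

end

theory Submission
  imports Defs
begin

text \<open>
  The iterates are Fejer monotone with respect to \<open>C = (\<Inter>j\<in>J. Fix (T j))\<close>, and averagedness makes the
  decrease of \<open>\<parallel>x t - c\<parallel>\<^sup>2\<close> over \<open>s\<close> steps dominate the squared residuals of all the operators.
  Hoelder regularity bounds the distance from \<open>x t\<close> to \<open>C\<close> by a power of the residuals, so
  \<open>b t = d(x t, C)\<^sup>2\<close> satisfies \<open>b t powr (1 / \<gamma>) \<le> A * (b t - b (t + s))\<close>. This recurrence forces
  the stated decay of \<open>b\<close>, and Fejer monotonicity gives \<open>\<parallel>x t - xbar\<parallel> \<le> 2 * d(x t, C)\<close>.
\<close>

section \<open>Convexity of the squared norm, and averaged operators\<close>

lemma norm_convex_combination_power2_le:
  fixes u :: "'j \<Rightarrow> 'a::real_normed_vector"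
  assumes "finite J" "\<And>j. j \<in> J \<Longrightarrow> w j \<ge> 0" "(\<Sum>j\<in>J. w j) = 1"
  shows "(norm (\<Sum>j\<in>J. w j *\<^sub>R u j))\<^sup>2 \<le> (\<Sum>j\<in>J. w j * (norm (u j))\<^sup>2)"
proof -
  have "norm (\<Sum>j\<in>J. w j *\<^sub>R u j) \<le> (\<Sum>j\<in>J. w j * norm (u j))"
    by (rule order_trans[OF norm_sum]) (simp add: assms(2))
  then have "(norm (\<Sum>j\<in>J. w j *\<^sub>R u j))\<^sup>2 \<le> (\<Sum>j\<in>J. w j * norm (u j))\<^sup>2"
    by (simp add: power_mono)
  also have "\<dots> \<le> (\<Sum>j\<in>J. w j * (norm (u j))\<^sup>2)"
  proof -
    have "J \<noteq> {}" using assms(3) by auto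
    then show ?thesis
      using convex_on_sum[OF assms(1) _ convex_power2 assms(3), of "\<lambda>j. norm (u j)"] assms(2)
      by simp
  qed
  finally show ?thesis .
qed

lemma averaged_pos: "averaged \<alpha> T \<Longrightarrow> 0 < \<alpha> \<and> \<alpha> < 1"
  by (simp add: averaged_def)

text \<open>The point \<open>c\<close> is fixed by \<open>R\<close> too, so
  \<open>v = R y - c\<close> is no longer than \<open>u = y - c\<close>. The identity for the
  squared norm of a convex combination of \<open>u\<close> and \<open>v\<close> produces the
  negative term in \<open>u - v\<close>, and \<open>y - T y = \<alpha> (u - v)\<close> converts it
  into the residual.\<close>

lemma averaged_Fix_decrease:
  fixes T :: "'a::real_inner \<Rightarrow> 'a"
  assumes "averaged \<alpha> T" and c: "c \<in> Fix T"
  shows "(norm (T y - c))\<^sup>2 \<le> (norm (y - c))\<^sup>2 - (1 - \<alpha>) / \<alpha> * (norm (y - T y))\<^sup>2"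
proof -
  obtain R where \<alpha>: "0 < \<alpha>" "\<alpha> < 1" and R: "nonexpansive R"
    and T: "T = (\<lambda>x. (1 - \<alpha>) *\<^sub>R x + \<alpha> *\<^sub>R R x)"
    using assms(1) by (auto simp: averaged_def)
  have "\<alpha> *\<^sub>R (R c - c) = 0" using c by (simp add: T Fix_def algebra_simps)
  then have Rc: "R c = c" using \<alpha> by simp
  define u where "u = y - c"
  define v where "v = R y - c"
  have vu: "(norm v)\<^sup>2 \<le> (norm u)\<^sup>2"
    using R Rc unfolding u_def v_def nonexpansive_def by (metis norm_ge_zero power_mono)
  have 1: "T y - c = (1 - \<alpha>) *\<^sub>R u + \<alpha> *\<^sub>R v" by (simp add: T u_def v_def algebra_simps)
  have 2: "y - T y = \<alpha> *\<^sub>R (u - v)" by (simp add: T u_def v_def algebra_simps)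
  have "(norm ((1 - \<alpha>) *\<^sub>R u + \<alpha> *\<^sub>R v))\<^sup>2
      = (1 - \<alpha>) * (norm u)\<^sup>2 + \<alpha> * (norm v)\<^sup>2 - \<alpha> * (1 - \<alpha>) * (norm (u - v))\<^sup>2"
    unfolding power2_norm_eq_inner
    by (simp add: inner_add_left inner_add_right inner_diff_left inner_diff_right inner_commute)
      (simp add: algebra_simps)
  also have "\<dots> \<le> (norm u)\<^sup>2 - \<alpha> * (1 - \<alpha>) * (norm (u - v))\<^sup>2"
    using mult_left_mono[OF vu, of \<alpha>] \<alpha> by (simp add: algebra_simps)
  also have "\<alpha> * (1 - \<alpha>) * (norm (u - v))\<^sup>2 = (1 - \<alpha>) / \<alpha> * (norm (\<alpha> *\<^sub>R (u - v)))\<^sup>2"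
    using \<alpha> by (simp add: power_mult_distrib power2_eq_square)
  finally show ?thesis unfolding 1 2 by (simp add: u_def)
qed

lemma averaged_nonexpansive:
  fixes T :: "'a::real_normed_vector \<Rightarrow> 'a"
  assumes "averaged \<alpha> T"
  shows "norm (T y - T z) \<le> norm (y - z)"
proof -
  obtain R where \<alpha>: "0 < \<alpha>" "\<alpha> < 1" and R: "nonexpansive R"
    and T: "T = (\<lambda>x. (1 - \<alpha>) *\<^sub>R x + \<alpha> *\<^sub>R R x)"
    using assms by (auto simp: averaged_def)
  have "T y - T z = (1 - \<alpha>) *\<^sub>R (y - z) + \<alpha> *\<^sub>R (R y - R z)"
    by (simp add: T algebra_simps)
  then have "norm (T y - T z) \<le> (1 - \<alpha>) * norm (y - z) + \<alpha> * norm (R y - R z)"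
    using \<alpha> norm_triangle_ineq[of "(1 - \<alpha>) *\<^sub>R (y - z)" "\<alpha> *\<^sub>R (R y - R z)"] by simp
  also have "\<dots> \<le> (1 - \<alpha>) * norm (y - z) + \<alpha> * norm (y - z)"
    using R \<alpha> by (simp add: nonexpansive_def)
  finally show ?thesis by (simp add: algebra_simps)
qed

lemma averaged_closed_Fix:
  fixes T :: "'a::real_normed_vector \<Rightarrow> 'a"
  assumes "averaged \<alpha> T"
  shows "closed (Fix T)"
proof -
  have "1-lipschitz_on UNIV T"
    using averaged_nonexpansive[OF assms] by (auto simp: lipschitz_on_def dist_norm)
  then have "continuous_on UNIV T" by (rule lipschitz_on_continuous_on)
  then show ?thesis unfolding Fix_def by (intro closed_Collect_eq) auto
qed

section \<open>Real powers and decay of scalar recurrences\<close>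

text \<open>Lets exponents be lowered on a bounded range. The surplus factor
  \<open>a powr (q - p)\<close> is at most \<open>N\<close>, because the surplus exponent lies
  between 0 and 1 and \<open>N\<close> is at least 1.\<close>

lemma powr_le_mult_powr_smaller_exponent:
  fixes a N p q :: real
  assumes "0 \<le> a" "a \<le> N" "1 \<le> N" "p \<le> q" "q \<le> p + 1"
  shows "a powr q \<le> N * a powr p"
proof -
  have "a powr q = a powr (q - p) * a powr p" by (simp flip: powr_add)
  also have "\<dots> \<le> N powr (q - p) * a powr p"
    using assms by (intro mult_right_mono powr_mono2) auto
  also have "\<dots> \<le> N powr 1 * a powr p"
    using assms by (intro mult_right_mono powr_mono) auto
  finally show ?thesis using assms by simp
qed

text \<open>Linearises the recurrence: in the variable \<open>u powr (- r)\<close> one step gains a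
  constant. With \<open>y = u powr r / A\<close> the hypothesis reads
  \<open>v \<le> u * (1 - y)\<close>, and Bernoulli's inequality for the exponent \<open>- r\<close>
  gives \<open>1 + r * y \<le> (1 - y) powr (- r)\<close>.\<close>

lemma powr_minus_decrease:
  fixes u v A r :: real
  assumes "0 < v" "0 < A" "0 < r" "u powr (1 + r) \<le> A * (u - v)"
  shows "v powr (- r) \<ge> u powr (- r) + r / A"
proof -
  have "v \<le> u"
    using assms by (smt (verit) powr_ge_zero zero_less_mult_iff mult_pos_neg)
  then have u: "0 < u" using assms by simp
  define y where "y = u powr r / A"
  have y0: "0 < y" using u assms by (simp add: y_def)
  have "v \<le> u * (1 - y)"
    using assms u by (simp add: y_def powr_add field_simps)
  then have y1: "y < 1" using \<open>0 < v\<close> u by (smt (verit) zero_less_mult_iff)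
  have "u powr (- r) + r / A = u powr (- r) * (1 + r * y)"
    using u assms by (simp add: y_def powr_minus field_simps)
  also have "\<dots> \<le> u powr (- r) * (1 - y) powr (- r)"
  proof (rule mult_left_mono)
    have "ln (1 - y) \<le> - y" using ln_le_minus_one[of "1 - y"] y1 by simp
    then have "r * y \<le> - r * ln (1 - y)"
      using mult_left_mono[of "ln (1 - y)" "- y" r] assms by (simp add: algebra_simps)
    then have "1 + r * y \<le> exp (- r * ln (1 - y))"
      using exp_ge_add_one_self[of "- r * ln (1 - y)"] by linarith
    then show "1 + r * y \<le> (1 - y) powr (- r)" using y1 by (simp add: powr_def)
  qed simp
  also have "\<dots> = (u * (1 - y)) powr (- r)" using u y1 by (simp add: powr_mult)
  also have "\<dots> \<le> v powr (- r)"
    using \<open>v \<le> u * (1 - y)\<close> assms by (intro powr_mono2') auto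
  finally show ?thesis .
qed

text \<open>By \<open>powr_minus_decrease\<close>, \<open>b t powr (- r)\<close> gains
  \<open>r / A\<close> every \<open>s\<close> steps and so grows at least linearly; inverting the
  power gives the rate.\<close>

lemma sublinear_rate_of_recurrence:
  fixes b :: "nat \<Rightarrow> real"
  assumes b0: "\<And>t. 0 \<le> b t" and dec: "\<And>t. b t \<le> b 0"
    and rec: "\<And>t. b t powr (1 + r) \<le> A * (b t - b (t + s))"
    and pos: "0 < s" "0 < A" "0 < r"
  shows "\<exists>c>0. \<forall>t\<ge>1. b t \<le> (c * real t) powr (- 1 / r)"
proof (cases "b 0 = 0")
  case True
  then have "b t = 0" for t using b0[of t] dec[of t] by simp
  then show ?thesis by (intro exI[of _ 1]) auto
next
  case False
  then have b0p: "0 < b 0" using b0[of 0] by simp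
  \<comment> \<open>The first entry starts the induction on the initial block \<open>t < s\<close>,
    the second carries it over a jump of length \<open>s\<close>.\<close>
  define c where "c = min (b 0 powr (- r) / s) (r / (A * s))"
  have c: "0 < c" using pos b0p by (simp add: c_def)
  have cs: "c * s \<le> b 0 powr (- r)" "c * s \<le> r / A"
    using mult_right_mono[OF min.cobounded1, of s "b 0 powr (- r) / s" "r / (A * s)"]
      mult_right_mono[OF min.cobounded2, of s "b 0 powr (- r) / s" "r / (A * s)"] pos
    by (simp_all add: c_def)
  \<comment> \<open>Positivity matters because \<open>0 powr (- r)\<close> is 0; where
    \<open>b t = 0\<close> the final bound is trivial.\<close>
  have inv: "b t powr (- r) \<ge> c * t" if "0 < b t" for t
    using that
  proof (induction t rule: less_induct)
    case (less t)
    show ?case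
    proof (cases "t < s")
      case True
      then have "c * t \<le> c * s" using c by simp
      also have "\<dots> \<le> b 0 powr (- r)" by (rule cs)
      also have "\<dots> \<le> b t powr (- r)" using less.prems dec pos by (intro powr_mono2') auto
      finally show ?thesis .
    next
      case False
      define t' where "t' = t - s"
      have t: "t = t' + s" using False by (simp add: t'_def)
      \<comment> \<open>A zero of \<open>b\<close> at \<open>t'\<close> would turn the recurrence
        into \<open>0 \<le> - A * b t\<close>.\<close>
      have "0 < b t'"
      proof (rule ccontr)
        assume "\<not> 0 < b t'"
        then have "b t' = 0" using b0[of t'] by simp
        then show False using rec[of t'] less.prems pos by (simp add: t mult_le_0_iff)
      qed
      then have "c * t' \<le> b t' powr (- r)" using less.IH[of t'] pos by (simp add: t)
      moreover have "b t powr (- r) \<ge> b t' powr (- r) + r / A"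
        using powr_minus_decrease[OF less.prems pos(2,3)] rec[of t'] by (simp add: t)
      ultimately show ?thesis using cs by (simp add: t algebra_simps)
    qed
  qed
  have "b t \<le> (c * real t) powr (- 1 / r)" if "t \<ge> 1" for t
  proof (cases "b t = 0")
    case False
    then have bt: "0 < b t" using b0[of t] by simp
    have "(b t powr (- r)) powr (- 1 / r) \<le> (c * real t) powr (- 1 / r)"
      using inv[OF bt] that c pos by (intro powr_mono2') auto
    then show ?thesis using bt pos by (simp add: powr_powr)
  qed simp
  then show ?thesis using c by blast
qed

text \<open>The recurrence and \<open>b (t + s) \<le> b t\<close> give
  \<open>(A + 1) * b (t + s) \<le> A * b t\<close>, a contraction by \<open>q\<close> over
  \<open>s\<close> steps; its \<open>s\<close>-th root \<open>r\<close> is the rate per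
  step.\<close>

lemma geometric_rate_of_recurrence:
  fixes b :: "nat \<Rightarrow> real"
  assumes b0: "\<And>t. 0 \<le> b t" and dec: "\<And>t. b t \<le> b 0"
    and rec: "\<And>t. b t \<le> A * (b t - b (t + s))"
    and pos: "0 < s" "0 < A"
  shows "\<exists>M\<ge>0. \<exists>r. 0 \<le> r \<and> r < 1 \<and> (\<forall>t. b t \<le> M * r ^ t)"
proof -
  define q where "q = A / (A + 1)"
  define r where "r = root s q"
  have q: "0 < q" "q < 1" using pos by (auto simp: q_def)
  have r: "0 < r" "r < 1" "r ^ s = q"
    using q pos by (auto simp: r_def)
  have step: "b (t + s) \<le> q * b t" for t
  proof -
    have "A * b (t + s) + b (t + s) \<le> A * b t + 0 \<or> b (t + s) > b t"
      using rec[of t] by (auto simp: algebra_simps)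
    moreover have "b (t + s) \<le> b t"
      using rec[of t] b0[of t] pos by (smt (verit) mult_pos_neg)
    ultimately have "(A + 1) * b (t + s) \<le> A * b t" by (simp add: algebra_simps)
    then show ?thesis using pos by (simp add: q_def field_simps)
  qed
  \<comment> \<open>Division by \<open>q\<close> pays for the initial block: there
    \<open>r ^ t\<close> may be below 1 but is at least \<open>r ^ s = q\<close>.\<close>
  have "b t \<le> b 0 / q * r ^ t" for t
  proof (induction t rule: less_induct)
    case (less t)
    show ?case
    proof (cases "t < s")
      case True
      then have "q \<le> r ^ t" using r power_decreasing[of t s r] by simp
      then have "b 0 \<le> b 0 / q * r ^ t"
        using q mult_left_mono[OF _ b0[of 0], of q "r ^ t"] by (simp add: field_simps)
      then show ?thesis using dec[of t] by simp
    next
      case False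
      define t' where "t' = t - s"
      have t: "t = t' + s" using False by (simp add: t'_def)
      have "b t \<le> q * (b 0 / q * r ^ t')"
        using step[of t'] less.IH[of t'] q pos mult_left_mono[of "b t'" "b 0 / q * r ^ t'" q]
        by (simp add: t)
      then show ?thesis by (simp add: t power_add r algebra_simps)
    qed
  qed
  moreover have "0 \<le> b 0 / q" using b0 q by simp
  ultimately show ?thesis using r by (meson less_imp_le)
qed

section \<open>The iteration: Fejer monotonicity and residual estimates\<close>

lemma le_infdist:
  assumes "C \<noteq> {}" "\<And>c. c \<in> C \<Longrightarrow> k \<le> dist y c"
  shows "k \<le> infdist y C"
  using assms by (auto simp: infdist_notempty intro: cINF_greatest)

text \<open>Here \<open>\<sigma>\<close> is any positive lower bound of the active weights.
  Regularity is kept out, so that error bounds with different exponents can be used for the same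
  iteration.\<close>

locale averaged_iteration =
  fixes J :: "'j set"
    and T :: "'j \<Rightarrow> 'a::{real_inner, complete_space} \<Rightarrow> 'a"
    and \<alpha> \<sigma> :: real
    and w :: "'j \<Rightarrow> nat \<Rightarrow> real"
    and x :: "nat \<Rightarrow> 'a"
    and s :: nat
  assumes fin: "finite J"
    and avg: "\<And>j. j \<in> J \<Longrightarrow> averaged \<alpha> (T j)"
    and common: "(\<Inter>j\<in>J. Fix (T j)) \<noteq> {}"
    and w_nonneg: "\<And>j t. j \<in> J \<Longrightarrow> w j t \<ge> 0"
    and w_sum: "\<And>t. (\<Sum>j\<in>J. w j t) = 1"
    and iter: "\<And>t. x (Suc t) = (\<Sum>j\<in>J. w j t *\<^sub>R T j (x t))"
    and \<sigma>_pos: "0 < \<sigma>"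
    and \<sigma>_le: "\<And>j t. j \<in> active J w t \<Longrightarrow> \<sigma> \<le> w j t"
    and cover: "\<And>t. (\<Union>i<s. active J w (t + i)) = J"
begin

abbreviation C where "C \<equiv> \<Inter>j\<in>J. Fix (T j)"

abbreviation res where "res j t \<equiv> norm (x t - T j (x t))"

lemma J_nonempty: "J \<noteq> {}"
  using w_sum[of 0] by auto

lemma \<alpha>: "0 < \<alpha>" "\<alpha> < 1"
  using avg averaged_pos J_nonempty by blast+

lemma s_pos: "0 < s"
  using cover[of 0] J_nonempty by (cases s) auto

lemma w_le_1: "j \<in> J \<Longrightarrow> w j t \<le> 1"
  using member_le_sum[of j J "\<lambda>j. w j t"] w_sum[of t] w_nonneg fin by auto

lemma \<sigma>_le_1: "\<sigma> \<le> 1"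
proof -
  obtain j where "j \<in> J" using J_nonempty by blast
  then have "j \<in> (\<Union>i<s. active J w (0 + i))" by (simp only: cover)
  then obtain i where "j \<in> active J w i" by auto
  then show ?thesis using \<sigma>_le[of j i] w_le_1[of j i] by (auto simp: active_def)
qed

definition \<kappa> where "\<kappa> = (1 - \<alpha>) / \<alpha>"

lemma \<kappa>_pos: "0 < \<kappa>"
  using \<alpha> by (simp add: \<kappa>_def)

text \<open>The weights sum to one, so \<open>x (Suc t) - c\<close> is a convex combination of the
  vectors \<open>T j (x t) - c\<close>; averaging \<open>averaged_Fix_decrease\<close> over
  \<open>j\<close> gives the claim.\<close>

lemma step_decrease:
  assumes "c \<in> C"
  shows "\<kappa> * (\<Sum>j\<in>J. w j t * (res j t)\<^sup>2) \<le> (norm (x t - c))\<^sup>2 - (norm (x (Suc t) - c))\<^sup>2"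
proof -
  have "x (Suc t) - c = (\<Sum>j\<in>J. w j t *\<^sub>R (T j (x t) - c))"
    using w_sum[of t]
    by (simp add: iter scaleR_diff_right sum_subtractf flip: scaleR_sum_left)
  then have "(norm (x (Suc t) - c))\<^sup>2 \<le> (\<Sum>j\<in>J. w j t * (norm (T j (x t) - c))\<^sup>2)"
    using norm_convex_combination_power2_le[of J "\<lambda>j. w j t"] fin w_nonneg w_sum by simp
  also have "\<dots> \<le> (\<Sum>j\<in>J. w j t * ((norm (x t - c))\<^sup>2 - \<kappa> * (res j t)\<^sup>2))"
    using assms averaged_Fix_decrease[OF avg] w_nonneg
    by (intro sum_mono mult_left_mono) (auto simp: \<kappa>_def)
  also have "\<dots> = (norm (x t - c))\<^sup>2 - \<kappa> * (\<Sum>j\<in>J. w j t * (res j t)\<^sup>2)"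
    using w_sum[of t]
    by (simp add: right_diff_distrib sum_subtractf sum_distrib_left mult.left_commute
        flip: sum_distrib_right)
  finally show ?thesis by simp
qed

text \<open>Bounds the displacement by the same weighted sum as in \<open>step_decrease\<close>, so
  a small decrease also forces a short step.\<close>

lemma step_move:
  "(norm (x (Suc t) - x t))\<^sup>2 \<le> (\<Sum>j\<in>J. w j t * (res j t)\<^sup>2)"
proof -
  have "x (Suc t) - x t = (\<Sum>j\<in>J. w j t *\<^sub>R (T j (x t) - x t))"
    using w_sum[of t]
    by (simp add: iter scaleR_diff_right sum_subtractf flip: scaleR_sum_left)
  then show ?thesis
    using norm_convex_combination_power2_le[of J "\<lambda>j. w j t" "\<lambda>j. T j (x t) - x t"]
      fin w_nonneg w_sum
    by (simp add: norm_minus_commute)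
qed

lemma Fejer:
  assumes "c \<in> C" "t \<le> t'"
  shows "norm (x t' - c) \<le> norm (x t - c)"
proof -
  have "norm (x (Suc t) - c) \<le> norm (x t - c)" for t
  proof (rule power2_le_imp_le)
    have "0 \<le> \<kappa> * (\<Sum>j\<in>J. w j t * (res j t)\<^sup>2)"
      using \<kappa>_pos w_nonneg by (intro mult_nonneg_nonneg sum_nonneg) auto
    then show "(norm (x (Suc t) - c))\<^sup>2 \<le> (norm (x t - c))\<^sup>2"
      using step_decrease[OF assms(1), of t] by linarith
  qed simp
  then show ?thesis using lift_Suc_antimono_le[of "\<lambda>t. norm (x t - c)"] assms(2) by simp
qed

lemma infdist_antimono:
  assumes "t \<le> t'"
  shows "infdist (x t') C \<le> infdist (x t) C"
  using common
proof (rule le_infdist)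
  fix c assume c: "c \<in> C"
  have "infdist (x t') C \<le> dist (x t') c" by (rule infdist_le[OF c])
  also have "\<dots> \<le> dist (x t) c" using Fejer[OF c assms] by (simp add: dist_norm)
  finally show "infdist (x t') C \<le> dist (x t) c" .
qed

text \<open>By \<open>Fejer\<close> both iterates are within \<open>dist (x t) c\<close> of each
  \<open>c\<close> in \<open>C\<close>. This yields the Cauchy property and, as \<open>t'\<close>
  tends to infinity, transfers rates for the distance to \<open>C\<close> to the norm.\<close>

lemma dist_iterates_le:
  assumes "t \<le> t'"
  shows "norm (x t' - x t) \<le> 2 * infdist (x t) C"
proof -
  have "norm (x t' - x t) / 2 \<le> infdist (x t) C"
    using common
  proof (rule le_infdist)
    fix c assume c: "c \<in> C"
    have "norm (x t' - x t) \<le> norm (x t' - c) + norm (x t - c)"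
      using norm_triangle_ineq4[of "x t' - c" "x t - c"] by simp
    then show "norm (x t' - x t) / 2 \<le> dist (x t) c"
      using Fejer[OF c assms] by (simp add: dist_norm)
  qed
  then show ?thesis by simp
qed

text \<open>The square comes from a drift of at most \<open>s\<close> steps, counted twice, plus one
  active residual; the denominator converts the decrease into the squared step bound.\<close>

definition L where "L = (2 * real s + 1)\<^sup>2 / (\<kappa> * \<sigma>)"

lemma L_pos: "0 < L"
  using \<kappa>_pos \<sigma>_pos by (simp add: L_def)

text \<open>
  Each operator is active at some time \<open>t + i\<close> with \<open>i < s\<close>, where its residual is controlled by
  the decrease of \<open>\<parallel>x - c\<parallel>\<^sup>2\<close>; the drift from \<open>x t\<close> to \<open>x (t + i)\<close> is controlled in the same way.
\<close>

lemma residual_le_decrease: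
  assumes c: "c \<in> C" and j: "j \<in> J"
  shows "(res j t)\<^sup>2 \<le> L * ((norm (x t - c))\<^sup>2 - (norm (x (t + s) - c))\<^sup>2)"
proof -
  define D where "D = (norm (x t - c))\<^sup>2 - (norm (x (t + s) - c))\<^sup>2"
  \<comment> \<open>Scaled so that each weighted residual sum in the window is at most
    \<open>\<sigma> * e\<^sup>2\<close>. Then \<open>e\<close> bounds both the steps, as
    \<open>\<sigma> \<le> 1\<close>, and the active residuals, whose weights are at least
    \<open>\<sigma>\<close>.\<close>
  define e where "e = sqrt (D / (\<kappa> * \<sigma>))"
  have D0: "0 \<le> D" unfolding D_def using Fejer[OF c, of t "t + s"] by (simp add: power_mono)
  then have e0: "0 \<le> e" using \<kappa>_pos \<sigma>_pos by (simp add: e_def)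
  have e2: "e\<^sup>2 = D / (\<kappa> * \<sigma>)" using D0 \<kappa>_pos \<sigma>_pos by (simp add: e_def)
  have sum_le: "(\<Sum>j\<in>J. w j (t + k) * (res j (t + k))\<^sup>2) \<le> \<sigma> * e\<^sup>2" if "k < s" for k
  proof -
    have "\<kappa> * (\<Sum>j\<in>J. w j (t + k) * (res j (t + k))\<^sup>2) \<le> D"
    proof -
      have "(norm (x (t + k) - c))\<^sup>2 \<le> (norm (x t - c))\<^sup>2"
        by (intro power_mono Fejer[OF c]) auto
      moreover have "(norm (x (t + s) - c))\<^sup>2 \<le> (norm (x (Suc (t + k)) - c))\<^sup>2"
        using that by (intro power_mono Fejer[OF c]) auto
      ultimately show ?thesis using step_decrease[OF c, of "t + k"] unfolding D_def by linarith
    qed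
    then show ?thesis using \<kappa>_pos \<sigma>_pos by (simp add: e2 field_simps)
  qed
  have move: "norm (x (Suc (t + k)) - x (t + k)) \<le> e" if "k < s" for k
  proof (rule power2_le_imp_le)
    have "(norm (x (Suc (t + k)) - x (t + k)))\<^sup>2 \<le> \<sigma> * e\<^sup>2"
      using step_move[of "t + k"] sum_le[OF that] by linarith
    also have "\<dots> \<le> 1 * e\<^sup>2" using \<sigma>_le_1 by (intro mult_right_mono) auto
    finally show "(norm (x (Suc (t + k)) - x (t + k)))\<^sup>2 \<le> e\<^sup>2" by simp
  qed (rule e0)
  have drift: "norm (x (t + i) - x t) \<le> i * e" if "i \<le> s" for i
    using that
  proof (induction i)
    case (Suc i)
    have "norm (x (t + Suc i) - x t)
        \<le> norm (x (Suc (t + i)) - x (t + i)) + norm (x (t + i) - x t)"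
      using norm_triangle_ineq[of "x (Suc (t + i)) - x (t + i)" "x (t + i) - x t"] by simp
    then show ?case using Suc move[of i] by (simp add: algebra_simps)
  qed simp
  obtain i where i: "i < s" and act: "j \<in> active J w (t + i)"
    using cover[of t] j by auto
  have act_res: "res j (t + i) \<le> e"
  proof (rule power2_le_imp_le)
    have "\<sigma> * (res j (t + i))\<^sup>2 \<le> w j (t + i) * (res j (t + i))\<^sup>2"
      using \<sigma>_le[OF act] by (intro mult_right_mono) auto
    also have "\<dots> \<le> (\<Sum>j\<in>J. w j (t + i) * (res j (t + i))\<^sup>2)"
      using w_nonneg fin j by (intro member_le_sum) auto
    also have "\<dots> \<le> \<sigma> * e\<^sup>2" by (rule sum_le[OF i])
    finally show "(res j (t + i))\<^sup>2 \<le> e\<^sup>2" using \<sigma>_pos by simp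
  qed (rule e0)
  \<comment> \<open>The detour through \<open>x (t + i)\<close> costs the drift twice, the second
    time because \<open>T j\<close> is nonexpansive.\<close>
  have "res j t \<le> norm (x t - x (t + i)) + res j (t + i) + norm (T j (x (t + i)) - T j (x t))"
    using norm_triangle_ineq[of "x t - x (t + i) + (x (t + i) - T j (x (t + i)))"
        "T j (x (t + i)) - T j (x t)"]
      norm_triangle_ineq[of "x t - x (t + i)" "x (t + i) - T j (x (t + i))"]
    by simp
  also have "norm (T j (x (t + i)) - T j (x t)) \<le> norm (x (t + i) - x t)"
    by (rule averaged_nonexpansive[OF avg[OF j]])
  finally have "res j t \<le> 2 * norm (x (t + i) - x t) + res j (t + i)"
    by (simp add: norm_minus_commute)
  also have "\<dots> \<le> 2 * (i * e) + e" using drift[of i] act_res i by simp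
  also have "\<dots> \<le> (2 * s + 1) * e" using i e0 by (simp add: algebra_simps mult_left_mono)
  finally have "(res j t)\<^sup>2 \<le> ((2 * s + 1) * e)\<^sup>2" by (simp add: power_mono)
  also have "\<dots> = L * D" by (simp add: power_mult_distrib e2 L_def)
  finally show ?thesis by (simp add: D_def)
qed

section \<open>From an error bound to decay of the distance and convergence\<close>

text \<open>Quantifying over all upper bounds \<open>R\<close> of the residuals, instead of taking
  their maximum, lets the bound be applied directly to \<open>sqrt (L * D)\<close>.\<close>

definition error_bound :: "real \<Rightarrow> bool" where
  "error_bound \<gamma> \<longleftrightarrow>
    (\<exists>B>0. \<forall>t R. (\<forall>j\<in>J. res j t \<le> R) \<longrightarrow> infdist (x t) C \<le> B * R powr \<gamma>)"

text \<open>The estimate is proved for every \<open>c\<close> in \<open>C\<close>, and the infimum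
  over \<open>c\<close> is taken only at the end, so no nearest point of \<open>C\<close> is
  chosen.\<close>

lemma infdist_recurrence:
  assumes "error_bound \<gamma>" "0 < \<gamma>"
  shows "\<exists>A>0. \<forall>t. ((infdist (x t) C)\<^sup>2) powr (1 / \<gamma>)
    \<le> A * ((infdist (x t) C)\<^sup>2 - (infdist (x (t + s)) C)\<^sup>2)"
proof -
  obtain B where B: "0 < B"
    and bound: "\<And>t R. (\<forall>j\<in>J. res j t \<le> R) \<Longrightarrow> infdist (x t) C \<le> B * R powr \<gamma>"
    using assms(1) by (auto simp: error_bound_def)
  \<comment> \<open>Raising \<open>b t \<le> B\<^sup>2 * (L * D) powr \<gamma>\<close> to the power
    \<open>1 / \<gamma>\<close> makes the right-hand side \<open>A * D\<close>.\<close>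
  define A where "A = (B\<^sup>2) powr (1 / \<gamma>) * L"
  have A: "0 < A" using B L_pos by (simp add: A_def)
  define b where "b t = (infdist (x t) C)\<^sup>2" for t
  have "b t powr (1 / \<gamma>) \<le> A * (b t - b (t + s))" for t
  proof -
    \<comment> \<open>The left-hand side does not depend on \<open>c\<close>, so the infimum over
      \<open>c\<close> replaces the right-hand side by \<open>b t\<close>.\<close>
    have *: "b t powr (1 / \<gamma>) / A + b (t + s) \<le> (norm (x t - c))\<^sup>2" if c: "c \<in> C" for c
    proof -
      define D where "D = (norm (x t - c))\<^sup>2 - (norm (x (t + s) - c))\<^sup>2"
      have D0: "0 \<le> D" unfolding D_def using Fejer[OF c, of t "t + s"] by (simp add: power_mono)
      have "\<forall>j\<in>J. res j t \<le> sqrt (L * D)"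
        using residual_le_decrease[OF c, of _ t] by (auto simp: D_def intro: real_le_rsqrt)
      then have "infdist (x t) C \<le> B * sqrt (L * D) powr \<gamma>" by (rule bound)
      then have "b t \<le> (B * sqrt (L * D) powr \<gamma>)\<^sup>2"
        unfolding b_def by (intro power_mono infdist_nonneg)
      also have "\<dots> = B\<^sup>2 * (L * D) powr \<gamma>"
        using L_pos D0
        by (simp add: power_mult_distrib power2_eq_square flip: powr_mult)
      finally have "b t powr (1 / \<gamma>) \<le> (B\<^sup>2 * (L * D) powr \<gamma>) powr (1 / \<gamma>)"
        using assms(2) by (intro powr_mono2) (auto simp: b_def)
      also have "\<dots> = A * D"
        using assms(2) L_pos D0 by (simp add: powr_mult powr_powr A_def)
      finally have "b t powr (1 / \<gamma>) / A \<le> D" using A by (simp add: field_simps)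
      moreover have "b (t + s) \<le> (norm (x (t + s) - c))\<^sup>2"
        unfolding b_def using infdist_le[OF c, of "x (t + s)"]
        by (intro power_mono infdist_nonneg) (simp add: dist_norm)
      ultimately show ?thesis by (simp add: D_def)
    qed
    have nonneg: "0 \<le> b t powr (1 / \<gamma>) / A + b (t + s)" using A by (simp add: b_def)
    have "sqrt (b t powr (1 / \<gamma>) / A + b (t + s)) \<le> infdist (x t) C"
      using common by (rule le_infdist) (auto simp: dist_norm intro!: real_le_lsqrt *)
    then have "b t powr (1 / \<gamma>) / A + b (t + s) \<le> b t"
      unfolding b_def using nonneg real_sqrt_le_iff sqrt_le_D by blast
    then show ?thesis using A by (simp add: field_simps)
  qed
  then show ?thesis using A by (auto simp: b_def)
qed

text \<open>With \<open>r = (1 - \<gamma>) / \<gamma>\<close>, positive since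
  \<open>\<gamma> < 1\<close>, the exponent \<open>1 / \<gamma>\<close> is \<open>1 + r\<close>. The
  squared distance decays with exponent \<open>- 1 / r\<close>, which the square root
  halves.\<close>

lemma infdist_sublinear:
  assumes "error_bound \<gamma>" "0 < \<gamma>" "\<gamma> < 1"
  shows "\<exists>M\<ge>0. \<forall>t\<ge>1. infdist (x t) C \<le> M * real t powr (- (\<gamma> / (2 * (1 - \<gamma>))))"
proof -
  define r where "r = (1 - \<gamma>) / \<gamma>"
  have r: "0 < r" "1 + r = 1 / \<gamma>" "- 1 / r / 2 = - (\<gamma> / (2 * (1 - \<gamma>)))"
    using assms by (auto simp: r_def field_simps)
  obtain A where "0 < A" "\<And>t. ((infdist (x t) C)\<^sup>2) powr (1 + r)
    \<le> A * ((infdist (x t) C)\<^sup>2 - (infdist (x (t + s)) C)\<^sup>2)"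
    using infdist_recurrence[OF assms(1,2)] r by auto
  then have "\<exists>c>0. \<forall>t\<ge>1. (infdist (x t) C)\<^sup>2 \<le> (c * real t) powr (- 1 / r)"
    using r s_pos infdist_antimono
    by (intro sublinear_rate_of_recurrence[where A = A and s = s])
      (auto intro: power_mono infdist_nonneg)
  then obtain c where c: "0 < c"
    and b: "\<And>t. t \<ge> 1 \<Longrightarrow> (infdist (x t) C)\<^sup>2 \<le> (c * real t) powr (- 1 / r)" by auto
  have "infdist (x t) C \<le> c powr (- 1 / r / 2) * real t powr (- 1 / r / 2)" if "t \<ge> 1" for t
  proof -
    have "infdist (x t) C \<le> sqrt ((c * real t) powr (- 1 / r))"
      using b[OF that] by (rule real_le_rsqrt)
    also have "\<dots> = (c * real t) powr (- 1 / r / 2)"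
      by (simp add: powr_powr flip: powr_half_sqrt)
    also have "\<dots> = c powr (- 1 / r / 2) * real t powr (- 1 / r / 2)"
      using c by (simp add: powr_mult)
    finally show ?thesis .
  qed
  then show ?thesis unfolding r(3) by (intro exI[of _ "c powr _"] conjI) auto
qed

text \<open>For exponent 1 the recurrence is linear in the squared distance; square roots of the
  constant and of the ratio give the bound.\<close>

lemma infdist_geometric:
  assumes "error_bound 1"
  shows "\<exists>M\<ge>0. \<exists>r. 0 \<le> r \<and> r < 1 \<and> (\<forall>t. infdist (x t) C \<le> M * r ^ t)"
proof -
  obtain A where "0 < A" "\<And>t. (infdist (x t) C)\<^sup>2
    \<le> A * ((infdist (x t) C)\<^sup>2 - (infdist (x (t + s)) C)\<^sup>2)"
    using infdist_recurrence[OF assms] by auto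
  then have "\<exists>M\<ge>0. \<exists>r. 0 \<le> r \<and> r < 1 \<and> (\<forall>t. (infdist (x t) C)\<^sup>2 \<le> M * r ^ t)"
    using s_pos infdist_antimono
    by (intro geometric_rate_of_recurrence[where A = A and s = s])
      (auto intro: power_mono infdist_nonneg)
  then obtain M r where M: "0 \<le> M" "0 \<le> r" "r < 1"
    and b: "\<And>t. (infdist (x t) C)\<^sup>2 \<le> M * r ^ t" by auto
  have "infdist (x t) C \<le> sqrt M * sqrt r ^ t" for t
    using real_le_rsqrt[OF b[of t]] by (simp add: real_sqrt_mult real_sqrt_power)
  then show ?thesis using M by (intro exI[of _ "sqrt M"] exI[of _ "sqrt r"] conjI) auto
qed

text \<open>The rate serves only to show that the distance to \<open>C\<close> tends to zero. Then
  \<open>dist_iterates_le\<close> makes the sequence Cauchy, closedness of \<open>C\<close> places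
  the limit in it, and the same lemma gives the bound in the limit.\<close>

lemma convergence:
  assumes "error_bound \<gamma>" "0 < \<gamma>" "\<gamma> < 1"
  shows "\<exists>xbar\<in>C. x \<longlonglongrightarrow> xbar \<and> (\<forall>t. norm (x t - xbar) \<le> 2 * infdist (x t) C)"
proof -
  define g where "g t = infdist (x t) C" for t
  obtain M where M: "\<And>t. t \<ge> 1 \<Longrightarrow> g t \<le> M * real t powr (- (\<gamma> / (2 * (1 - \<gamma>))))"
    using infdist_sublinear[OF assms] by (auto simp: g_def)
  have "(\<lambda>t. M * real t powr (- (\<gamma> / (2 * (1 - \<gamma>))))) \<longlonglongrightarrow> M * 0"
    using assms by (intro tendsto_mult tendsto_const tendsto_neg_powr filterlim_real_sequentially) auto
  moreover have "\<forall>\<^sub>F t in sequentially. norm (g t) \<le> M * real t powr (- (\<gamma> / (2 * (1 - \<gamma>))))"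
    using eventually_ge_at_top[of 1] by eventually_elim (use M in \<open>simp add: g_def infdist_nonneg\<close>)
  ultimately have g: "g \<longlonglongrightarrow> 0"
    by (intro Lim_null_comparison[where f = g]) simp_all
  have near: "norm (x t' - x t) \<le> 2 * g t" if "t \<le> t'" for t t'
    using dist_iterates_le[OF that] by (simp add: g_def)
  have "Cauchy x"
  proof (rule metric_CauchyI)
    fix e :: real assume "0 < e"
    then obtain N where N: "g N < e / 4"
      using order_tendstoD(2)[OF g, of "e / 4"] by (auto simp: eventually_sequentially)
    have "dist (x m) (x n) < e" if "m \<ge> N" "n \<ge> N" for m n
      using near[OF that(1)] near[OF that(2)] N dist_triangle2[of "x m" "x n" "x N"]
      by (simp add: dist_norm)
    then show "\<exists>N. \<forall>m\<ge>N. \<forall>n\<ge>N. dist (x m) (x n) < e" by blast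
  qed
  then obtain xbar where lim: "x \<longlonglongrightarrow> xbar"
    using Cauchy_convergent_iff convergent_def by blast
  have "g \<longlonglongrightarrow> infdist xbar C" unfolding g_def by (intro tendsto_infdist lim)
  then have "infdist xbar C = 0" using g LIMSEQ_unique by blast
  moreover have "closed C" using averaged_closed_Fix[OF avg] by auto
  ultimately have "xbar \<in> C" using common in_closed_iff_infdist_zero by blast
  moreover have "norm (x t - xbar) \<le> 2 * infdist (x t) C" for t
  proof -
    have "(\<lambda>t'. norm (x t' - x t)) \<longlonglongrightarrow> norm (xbar - x t)" by (intro tendsto_intros lim)
    then have "norm (xbar - x t) \<le> 2 * infdist (x t) C"
      by (rule LIMSEQ_le_const2) (use dist_iterates_le in blast)
    then show ?thesis by (simp add: norm_minus_commute)
  qed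
  ultimately show ?thesis using lim by blast
qed

section \<open>From Hoelder regularity to an error bound\<close>

lemma bounded_range: "bounded (range x)"
proof -
  obtain c where c: "c \<in> C" using common by blast
  have "range x \<subseteq> cball c (norm (x 0 - c))"
    using Fejer[OF c, of 0] by (auto simp: dist_norm norm_minus_commute)
  then show ?thesis using bounded_subset bounded_cball by blast
qed

text \<open>Regularity on the bounded set \<open>range x\<close> bounds the distances to the single
  fixed point sets, and the intersection property then bounds the distance to \<open>C\<close>, so
  the exponents multiply. Since the residuals are bounded, exponents may be lowered to the minimum
  of the \<open>\<gamma>\<^sub>1 j\<close> and finally to \<open>\<gamma>\<close>.\<close>

lemma error_boundI:
  assumes \<gamma>\<^sub>1: "\<And>j. j \<in> J \<Longrightarrow> 0 < \<gamma>\<^sub>1 j \<and> \<gamma>\<^sub>1 j \<le> 1"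
    and reg: "\<And>j. j \<in> J \<Longrightarrow>
      \<exists>\<mu>>0. \<forall>y\<in>range x. infdist y (Fix (T j)) \<le> \<mu> * norm (y - T j y) powr \<gamma>\<^sub>1 j"
    and \<gamma>\<^sub>2: "0 < \<gamma>\<^sub>2" "\<gamma>\<^sub>2 \<le> 1"
    and inter: "\<exists>\<beta>>0. \<forall>y\<in>range x.
      infdist y C \<le> \<beta> * (MAX j\<in>J. infdist y (Fix (T j))) powr \<gamma>\<^sub>2"
    and \<gamma>: "0 < \<gamma>" "\<gamma> \<le> (MIN j\<in>J. \<gamma>\<^sub>1 j) * \<gamma>\<^sub>2"
  shows "error_bound \<gamma>"
proof -
  obtain c where c: "c \<in> C" using common by blast
  define N where "N = max 1 (2 * norm (x 0 - c))"
  have resN: "res j t \<le> N" if "j \<in> J" for j t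
  proof -
    have "T j c = c" using c that by (auto simp: Fix_def)
    then have "norm (T j (x t) - c) \<le> norm (x t - c)"
      using averaged_nonexpansive[OF avg[OF that], of "x t" c] by simp
    then have "res j t \<le> 2 * norm (x t - c)"
      using norm_triangle_ineq4[of "x t - c" "T j (x t) - c"] by simp
    then show ?thesis using Fejer[OF c, of 0 t] by (simp add: N_def)
  qed
  obtain \<mu> where \<mu>: "\<And>j. j \<in> J \<Longrightarrow> 0 < \<mu> j"
    "\<And>j t. j \<in> J \<Longrightarrow> infdist (x t) (Fix (T j)) \<le> \<mu> j * res j t powr \<gamma>\<^sub>1 j"
  proof -
    have "\<forall>j\<in>J. \<exists>\<mu>>0. \<forall>t. infdist (x t) (Fix (T j)) \<le> \<mu> * res j t powr \<gamma>\<^sub>1 j"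
      using reg by fast
    then show ?thesis using that by (metis (no_types))
  qed
  obtain \<beta> where \<beta>: "0 < \<beta>"
    "\<And>t. infdist (x t) C \<le> \<beta> * (MAX j\<in>J. infdist (x t) (Fix (T j))) powr \<gamma>\<^sub>2"
    using inter by auto
  define m where "m = (MAX j\<in>J. \<mu> j)"
  define \<delta> where "\<delta> = (MIN j\<in>J. \<gamma>\<^sub>1 j)"
  have m: "\<mu> j \<le> m" if "j \<in> J" for j using that fin by (simp add: m_def)
  have m0: "0 < m" using m \<mu>(1) J_nonempty by fastforce
  have \<delta>_le: "\<delta> \<le> \<gamma>\<^sub>1 j" if "j \<in> J" for j using that fin by (simp add: \<delta>_def)
  have \<delta>: "0 < \<delta>" using fin J_nonempty \<gamma>\<^sub>1 by (simp add: \<delta>_def)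
  have "\<delta> \<le> 1" using \<delta>_le \<gamma>\<^sub>1 J_nonempty by fastforce
  \<comment> \<open>With \<open>0 < \<gamma>\<close> this bounds the surplus exponent by 1 when
    \<open>\<delta> * \<gamma>\<^sub>2\<close> is lowered to \<open>\<gamma>\<close>.\<close>
  then have \<delta>\<gamma>: "\<delta> * \<gamma>\<^sub>2 \<le> 1" using \<gamma>\<^sub>2 \<delta> by (simp add: mult_le_one)
  define B where "B = \<beta> * (m * N) powr \<gamma>\<^sub>2 * N"
  have N1: "1 \<le> N" by (simp add: N_def)
  have B0: "0 < B" using \<beta> m0 N1 by (simp add: B_def)
  have "infdist (x t) C \<le> B * R powr \<gamma>" if R: "\<forall>j\<in>J. res j t \<le> R" for t R
  proof -
    \<comment> \<open>An arbitrary \<open>R\<close> may exceed \<open>N\<close>, where exponents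
      cannot be lowered at the cost of a factor \<open>N\<close>. The truncated value still bounds
      all residuals, and monotonicity restores \<open>R\<close> at the end.\<close>
    define R' where "R' = min R N"
    have R': "res j t \<le> R'" if "j \<in> J" for j using R resN that by (simp add: R'_def)
    have R'0: "0 \<le> R'" using R' J_nonempty norm_ge_zero order_trans by blast
    have "infdist (x t) (Fix (T j)) \<le> m * N * R' powr \<delta>" if j: "j \<in> J" for j
    proof -
      have "infdist (x t) (Fix (T j)) \<le> \<mu> j * res j t powr \<gamma>\<^sub>1 j" by (rule \<mu>(2)[OF j])
      also have "\<dots> \<le> m * R' powr \<gamma>\<^sub>1 j"
        using m[OF j] m0 R'[OF j] \<gamma>\<^sub>1[OF j] by (intro mult_mono powr_mono2) auto
      also have "\<dots> \<le> m * (N * R' powr \<delta>)"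
        using m0 R'0 N1 \<gamma>\<^sub>1[OF j] \<delta>_le[OF j] \<delta>
        by (intro mult_left_mono powr_le_mult_powr_smaller_exponent) (auto simp: R'_def)
      finally show ?thesis by (simp add: mult.assoc)
    qed
    then have max_le: "(MAX j\<in>J. infdist (x t) (Fix (T j))) \<le> m * N * R' powr \<delta>"
      using fin J_nonempty by simp
    have max_ge: "0 \<le> (MAX j\<in>J. infdist (x t) (Fix (T j)))"
      using fin J_nonempty by (auto simp: Max_ge_iff infdist_nonneg)
    have "infdist (x t) C \<le> \<beta> * (MAX j\<in>J. infdist (x t) (Fix (T j))) powr \<gamma>\<^sub>2" by (rule \<beta>(2))
    also have "\<dots> \<le> \<beta> * (m * N * R' powr \<delta>) powr \<gamma>\<^sub>2"
      using \<beta>(1) max_le max_ge \<gamma>\<^sub>2 by (intro mult_left_mono powr_mono2) auto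
    also have "\<dots> = \<beta> * (m * N) powr \<gamma>\<^sub>2 * R' powr (\<delta> * \<gamma>\<^sub>2)"
      using m0 N1 by (simp add: powr_mult powr_powr)
    also have "\<dots> \<le> \<beta> * (m * N) powr \<gamma>\<^sub>2 * (N * R' powr \<gamma>)"
      using \<beta>(1) R'0 N1 \<gamma> \<delta>\<gamma>
      by (intro mult_left_mono powr_le_mult_powr_smaller_exponent) (auto simp: R'_def \<delta>_def)
    also have "\<dots> = B * R' powr \<gamma>" by (simp add: B_def)
    also have "\<dots> \<le> B * R powr \<gamma>"
      using B0 R'0 \<gamma> by (intro mult_left_mono powr_mono2) (auto simp: R'_def)
    finally show ?thesis .
  qed
  then show ?thesis using B0 by (auto simp: error_bound_def)
qed

end

section \<open>Instantiating the iteration and choosing the exponents\<close>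

theorem theorem3p3:
  fixes J :: "'j set"
    and T :: "'j \<Rightarrow> 'a::{real_inner, complete_space} \<Rightarrow> 'a"
    and \<alpha> :: real
    and w :: "'j \<Rightarrow> nat \<Rightarrow> real"
    and x :: "nat \<Rightarrow> 'a"
  assumes "finite J"
    and "0 < \<alpha>" and "\<alpha> < 1"
    and "\<And>j. j \<in> J \<Longrightarrow> averaged \<alpha> (T j)"
    and "(\<Inter>j\<in>J. Fix (T j)) \<noteq> {}"
    and "\<And>j t. j \<in> J \<Longrightarrow> w j t \<ge> 0"
    and "\<And>t. (\<Sum>j\<in>J. w j t) = 1"
    and "\<And>t. x (Suc t) = (\<Sum>j\<in>J. w j t *\<^sub>R T j (x t))"
    and "(INF t. INF j\<in>active J w t. w j t) > 0"
    and "\<exists>s. \<forall>t. (\<Union>i<s. active J w (t + i)) = J"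
  shows
    "((\<forall>j\<in>J. bounded_hoelder_regular (T j)) \<and>
      bounded_hoelder_regular_intersection J (\<lambda>j. Fix (T j))
      \<longrightarrow> (\<exists>xbar \<in> (\<Inter>j\<in>J. Fix (T j)).
            x \<longlonglongrightarrow> xbar \<and>
            (\<exists>\<rho>>0. \<exists>M\<ge>0. \<forall>t\<ge>1. norm (x t - xbar) \<le> M * real t powr (- \<rho>))))
     \<and>
     (\<forall>\<gamma>\<^sub>1 \<gamma>\<^sub>2 \<gamma>.
        (\<forall>j\<in>J. bounded_hoelder_regular_uniform (\<gamma>\<^sub>1 j) (T j)) \<and>
        bounded_hoelder_regular_intersection_uniform \<gamma>\<^sub>2 J (\<lambda>j. Fix (T j)) \<and>
        \<gamma> = (MIN j\<in>J. \<gamma>\<^sub>1 j) * \<gamma>\<^sub>2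
        \<longrightarrow> (\<exists>xbar \<in> (\<Inter>j\<in>J. Fix (T j)).
              x \<longlonglongrightarrow> xbar \<and>
              (\<exists>M\<^sub>1\<ge>0. \<exists>M\<^sub>2\<ge>0. \<exists>r. 0 \<le> r \<and> r < 1 \<and>
                (\<forall>t\<ge>1.
                  (0 < \<gamma> \<and> \<gamma> < 1 \<longrightarrow>
                    norm (x t - xbar) \<le> M\<^sub>1 * real t powr (- (\<gamma> / (2 * (1 - \<gamma>))))) \<and>
                  (\<gamma> = 1 \<longrightarrow> norm (x t - xbar) \<le> M\<^sub>2 * r ^ t)))))"
proof -
  define \<sigma> where "\<sigma> = (INF t. INF j\<in>active J w t. w j t)"
  obtain s where s: "\<And>t. (\<Union>i<s. active J w (t + i)) = J" using assms(10) by blast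
  have fin_active: "finite (active J w t)" for t using assms(1) by (simp add: active_def)
  \<comment> \<open>An infimum over an empty index set would carry no information about the
    weights.\<close>
  have active_nonempty: "active J w t \<noteq> {}" for t
  proof
    assume "active J w t = {}"
    then have "(\<Sum>j\<in>J. w j t) \<le> 0"
      by (intro sum_nonpos) (auto simp: active_def not_less)
    then show False using assms(7)[of t] by simp
  qed
  have "0 \<le> (INF j\<in>active J w t. w j t)" for t
    using active_nonempty by (intro cINF_greatest) (auto simp: active_def)
  then have bdd: "bdd_below (range (\<lambda>t. INF j\<in>active J w t. w j t))"
    by (intro bdd_belowI[of _ 0]) auto
  have \<sigma>_le: "\<sigma> \<le> w j t" if "j \<in> active J w t" for j t
  proof -
    have "\<sigma> \<le> (INF j\<in>active J w t. w j t)"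
      unfolding \<sigma>_def by (rule cINF_lower[OF bdd]) simp
    also have "\<dots> \<le> w j t" using fin_active that by (intro cINF_lower) auto
    finally show ?thesis .
  qed
  interpret averaged_iteration J T \<alpha> \<sigma> w x s
    using assms(1,4-9) s \<sigma>_le by unfold_locales (auto simp: \<sigma>_def)
  have Min_pos: "0 < (MIN j\<in>J. \<gamma>\<^sub>1 j) * \<gamma>\<^sub>2"
    if "\<And>j. j \<in> J \<Longrightarrow> 0 < \<gamma>\<^sub>1 j" "0 < \<gamma>\<^sub>2" for \<gamma>\<^sub>1 :: "'j \<Rightarrow> real" and \<gamma>\<^sub>2
    using that assms(1) J_nonempty by simp
  have Min_le: "(MIN j\<in>J. \<gamma>\<^sub>1 j) * \<gamma>\<^sub>2 \<le> 1"
    if "\<And>j. j \<in> J \<Longrightarrow> 0 < \<gamma>\<^sub>1 j \<and> \<gamma>\<^sub>1 j \<le> 1" "0 < \<gamma>\<^sub>2" "\<gamma>\<^sub>2 \<le> 1" for \<gamma>\<^sub>1 :: "'j \<Rightarrow> real" and \<gamma>\<^sub>2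
  proof -
    have "(MIN j\<in>J. \<gamma>\<^sub>1 j) \<le> 1"
      using that(1) assms(1) J_nonempty by (auto simp: Min_le_iff)
    then show ?thesis using that assms(1) J_nonempty by (intro mult_le_one) auto
  qed
  show ?thesis
  proof (intro conjI allI impI; elim conjE)
    assume reg: "\<forall>j\<in>J. bounded_hoelder_regular (T j)"
      and inter: "bounded_hoelder_regular_intersection J (\<lambda>j. Fix (T j))"
    have "\<forall>j\<in>J. \<exists>\<gamma> \<mu>. 0 < \<gamma> \<and> \<gamma> \<le> 1 \<and> 0 < \<mu> \<and>
        (\<forall>y\<in>range x. infdist y (Fix (T j)) \<le> \<mu> * norm (y - T j y) powr \<gamma>)"
      using reg bounded_range unfolding bounded_hoelder_regular_def by blast
    then obtain \<gamma>\<^sub>1 where \<gamma>\<^sub>1: "\<And>j. j \<in> J \<Longrightarrow> 0 < \<gamma>\<^sub>1 j \<and> \<gamma>\<^sub>1 j \<le> 1"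
        "\<And>j. j \<in> J \<Longrightarrow>
          \<exists>\<mu>>0. \<forall>y\<in>range x. infdist y (Fix (T j)) \<le> \<mu> * norm (y - T j y) powr \<gamma>\<^sub>1 j"
      by metis
    obtain \<gamma>\<^sub>2 where \<gamma>\<^sub>2: "0 < \<gamma>\<^sub>2" "\<gamma>\<^sub>2 \<le> 1"
        "\<exists>\<beta>>0. \<forall>y\<in>range x. infdist y C \<le> \<beta> * (MAX j\<in>J. infdist y (Fix (T j))) powr \<gamma>\<^sub>2"
      using inter bounded_range unfolding bounded_hoelder_regular_intersection_def by metis
    \<comment> \<open>An error bound with exponent \<open>\<gamma>\<close> implies one with any smaller exponent; halving avoids \<open>\<gamma> = 1\<close>.\<close>
    define \<gamma> where "\<gamma> = (MIN j\<in>J. \<gamma>\<^sub>1 j) * \<gamma>\<^sub>2 / 2"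
    have "0 < (MIN j\<in>J. \<gamma>\<^sub>1 j) * \<gamma>\<^sub>2" "(MIN j\<in>J. \<gamma>\<^sub>1 j) * \<gamma>\<^sub>2 \<le> 1"
      using Min_pos Min_le \<gamma>\<^sub>1(1) \<gamma>\<^sub>2 by blast+
    then have \<gamma>: "0 < \<gamma>" "\<gamma> < 1" "\<gamma> \<le> (MIN j\<in>J. \<gamma>\<^sub>1 j) * \<gamma>\<^sub>2"
      unfolding \<gamma>_def by linarith+
    have eb: "error_bound \<gamma>"
      by (rule error_boundI[of \<gamma>\<^sub>1 \<gamma>\<^sub>2]) (use \<gamma>\<^sub>1 \<gamma>\<^sub>2 \<gamma> in auto)
    define \<rho> where "\<rho> = \<gamma> / (2 * (1 - \<gamma>))"
    obtain M where M: "0 \<le> M" "\<And>t. t \<ge> 1 \<Longrightarrow> infdist (x t) C \<le> M * real t powr - \<rho>"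
      using infdist_sublinear[OF eb \<gamma>(1,2)] by (auto simp: \<rho>_def)
    obtain xbar where xbar: "xbar \<in> C" "x \<longlonglongrightarrow> xbar"
        "\<And>t. norm (x t - xbar) \<le> 2 * infdist (x t) C"
      using convergence[OF eb \<gamma>(1,2)] by blast
    have "norm (x t - xbar) \<le> 2 * M * real t powr - \<rho>" if "t \<ge> 1" for t
      using xbar(3)[of t] M(2)[OF that] by linarith
    moreover have "0 < \<rho>" "0 \<le> 2 * M" using \<gamma> M by (simp_all add: \<rho>_def)
    ultimately show "\<exists>xbar\<in>C. x \<longlonglongrightarrow> xbar \<and>
        (\<exists>\<rho>>0. \<exists>M\<ge>0. \<forall>t\<ge>1. norm (x t - xbar) \<le> M * real t powr (- \<rho>))"
      using xbar(1,2) by blast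
  next
    fix \<gamma>\<^sub>1 :: "'j \<Rightarrow> real" and \<gamma>\<^sub>2 \<gamma> :: real
    assume reg: "\<forall>j\<in>J. bounded_hoelder_regular_uniform (\<gamma>\<^sub>1 j) (T j)"
      and inter: "bounded_hoelder_regular_intersection_uniform \<gamma>\<^sub>2 J (\<lambda>j. Fix (T j))"
      and \<gamma>_eq: "\<gamma> = (MIN j\<in>J. \<gamma>\<^sub>1 j) * \<gamma>\<^sub>2"
    have \<gamma>\<^sub>1: "\<And>j. j \<in> J \<Longrightarrow> 0 < \<gamma>\<^sub>1 j \<and> \<gamma>\<^sub>1 j \<le> 1"
        "\<And>j. j \<in> J \<Longrightarrow>
          \<exists>\<mu>>0. \<forall>y\<in>range x. infdist y (Fix (T j)) \<le> \<mu> * norm (y - T j y) powr \<gamma>\<^sub>1 j"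
      using reg bounded_range unfolding bounded_hoelder_regular_uniform_def by blast+
    have \<gamma>\<^sub>2: "0 < \<gamma>\<^sub>2" "\<gamma>\<^sub>2 \<le> 1"
        "\<exists>\<beta>>0. \<forall>y\<in>range x. infdist y C \<le> \<beta> * (MAX j\<in>J. infdist y (Fix (T j))) powr \<gamma>\<^sub>2"
      using inter bounded_range unfolding bounded_hoelder_regular_intersection_uniform_def
      by blast+
    have \<gamma>: "0 < \<gamma>" "\<gamma> \<le> 1"
      unfolding \<gamma>_eq using Min_pos Min_le \<gamma>\<^sub>1(1) \<gamma>\<^sub>2 by blast+
    \<comment> \<open>Used with \<open>\<gamma>\<close> itself for the rates and with
      \<open>\<gamma> / 2\<close> for the existence of the limit, where the exponent must be below
      1.\<close>
    have eb: "error_bound \<gamma>'" if "0 < \<gamma>'" "\<gamma>' \<le> \<gamma>" for \<gamma>'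
      by (rule error_boundI[of \<gamma>\<^sub>1 \<gamma>\<^sub>2]) (use \<gamma>\<^sub>1 \<gamma>\<^sub>2 that in \<open>auto simp: \<gamma>_eq\<close>)
    obtain xbar where xbar: "xbar \<in> C" "x \<longlonglongrightarrow> xbar"
        "\<And>t. norm (x t - xbar) \<le> 2 * infdist (x t) C"
      using convergence[OF eb, of "\<gamma> / 2"] \<gamma> by auto
    \<comment> \<open>The limit is fixed before the cases are split, so both rates refer to the same
      point; in the case that does not occur the claim is vacuous.\<close>
    have "\<exists>M\<ge>0. \<forall>t\<ge>1. 0 < \<gamma> \<and> \<gamma> < 1 \<longrightarrow>
        norm (x t - xbar) \<le> M * real t powr (- (\<gamma> / (2 * (1 - \<gamma>))))"
    proof (cases "\<gamma> < 1")
      case True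
      obtain M where M: "0 \<le> M"
          "\<And>t. t \<ge> 1 \<Longrightarrow> infdist (x t) C \<le> M * real t powr (- (\<gamma> / (2 * (1 - \<gamma>))))"
        using infdist_sublinear[OF eb \<gamma>(1) True] \<gamma>(1) by auto
      have "norm (x t - xbar) \<le> 2 * M * real t powr (- (\<gamma> / (2 * (1 - \<gamma>))))" if "t \<ge> 1" for t
        using xbar(3)[of t] M(2)[OF that] by linarith
      then show ?thesis using M(1) by (intro exI[of _ "2 * M"]) auto
    qed auto
    moreover have "\<exists>M\<ge>0. \<exists>r. 0 \<le> r \<and> r < 1 \<and>
        (\<forall>t\<ge>1. \<gamma> = 1 \<longrightarrow> norm (x t - xbar) \<le> M * r ^ t)"
    proof (cases "\<gamma> = 1")
      case True
      obtain M r where M: "0 \<le> M" "0 \<le> r" "r < 1" "\<And>t. infdist (x t) C \<le> M * r ^ t"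
        using infdist_geometric[OF eb] True by auto
      have "norm (x t - xbar) \<le> 2 * M * r ^ t" for t
        using xbar(3)[of t] M(4)[of t] by linarith
      then show ?thesis using M(1-3) by (intro exI[of _ "2 * M"] exI[of _ r] conjI) auto
    qed (auto intro: exI[of _ 0])
    ultimately show "\<exists>xbar\<in>C. x \<longlonglongrightarrow> xbar \<and>
        (\<exists>M\<^sub>1\<ge>0. \<exists>M\<^sub>2\<ge>0. \<exists>r. 0 \<le> r \<and> r < 1 \<and>
          (\<forall>t\<ge>1.
            (0 < \<gamma> \<and> \<gamma> < 1 \<longrightarrow>
              norm (x t - xbar) \<le> M\<^sub>1 * real t powr (- (\<gamma> / (2 * (1 - \<gamma>))))) \<and>
            (\<gamma> = 1 \<longrightarrow> norm (x t - xbar) \<le> M\<^sub>2 * r ^ t)))"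
      using xbar(1,2) by meson
  qed
qed

end
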